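(* Let $T=(V,E)$ be a finite tree that is not a path or a star, and let its metric $w(t)$ evolve under the Ricci flow $\frac{d}{dt}w_h=-\kappa_h w_h$, $h\in E$, from an initial metric in $\mathbb{R}_{>0}^E$. Let $f=uv$ be an internal edge, and for a vertex $x$ let $d'_x$ be the number of leaf edges incident to $x$. If ($d_u=2$ or $d'_u\ge d_u-2$) and ($d_v=2$ or $d'_v\ge d_v-2$), then $\lim_{t\to\infty}\kappa_f(t)=0$.
   Context: Trees are finite and connected; $d_u$ is the degree of $u$. Leaf edge: an edge with an endpoint of degree $1$; all other edges are internal. For a metric $w\in\mathbb{R}_{>0}^{E}$, let $d(x,y)$ be the weighted path distance and $D_x=\sum_{z\sim x}1/w_{xz}$. The curvature is the Lin-Lu-Yau version of Ollivier Ricci curvature with parameter function $\gamma(x)=1/x$: let $\mu_x^\alpha$ be the probability measure with $\mu_x^\alpha(x)=\alpha$, $\mu_x^\alpha(y)=(1-\alpha)\frac{1/w_{xy}}{D_x}$ for $y\sim x$, and $0$ otherwise; with $W$ the $L^1$ transportation distance for $d$, set $\kappa_\alpha(x,y)=1-W(\mu_x^\alpha,\mu_y^\alpha)/d(x,y)$ and $\kappa_{xy}=\lim_{\alpha\to1}\kappa_\alpha(x,y)/(1-\alpha)$. On a tree, for an edge $uv$, $\kappa_{uv}=\frac{2-d_u}{w_{uv}D_u}+\frac{2-d_v}{w_{uv}D_v}$. $\kappa_e(t)$ is the curvature with respect to $w(t)$. The flow has a unique positive solution for all $t\ge0$. *)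

theory Defs
  imports "HOL-Probability.Probability"
begin

text \<open>
  A finite simple graph is a vertex set together with a set of two-element edges.  A metric is an
  edge weight \<open>w :: 'a set \<Rightarrow> real\<close>; only its values on the edges are ever used.
\<close>

definition simple_graph :: "'a set \<Rightarrow> 'a set set \<Rightarrow> bool" where
  "simple_graph V E \<longleftrightarrow> finite V \<and> (\<forall>e\<in>E. e \<subseteq> V \<and> card e = 2)"

definition nbrs :: "'a set set \<Rightarrow> 'a \<Rightarrow> 'a set" where
  "nbrs E x = {y. {x, y} \<in> E}"

definition paths :: "'a set set \<Rightarrow> 'a \<Rightarrow> 'a \<Rightarrow> 'a list set" where
  "paths E x y = {p. p \<noteq> [] \<and> distinct p \<and> successively (\<lambda>a b. {a, b} \<in> E) p
                     \<and> hd p = x \<and> last p = y}"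

definition path_edges :: "'a list \<Rightarrow> 'a set list" where
  "path_edges p = map2 (\<lambda>a b. {a, b}) p (tl p)"

definition connected_graph :: "'a set \<Rightarrow> 'a set set \<Rightarrow> bool" where
  "connected_graph V E \<longleftrightarrow> V \<noteq> {} \<and> (\<forall>x\<in>V. \<forall>y\<in>V. paths E x y \<noteq> {})"

definition cycle :: "'a set set \<Rightarrow> 'a list \<Rightarrow> bool" where
  "cycle E c \<longleftrightarrow> length c \<ge> 3 \<and> distinct c \<and> successively (\<lambda>a b. {a, b} \<in> E) c
                 \<and> {last c, hd c} \<in> E"

definition finite_tree :: "'a set \<Rightarrow> 'a set set \<Rightarrow> bool" where
  "finite_tree V E \<longleftrightarrow> simple_graph V E \<and> connected_graph V E \<and> (\<nexists>c. cycle E c)"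

definition path_graph :: "'a set \<Rightarrow> 'a set set \<Rightarrow> bool" where
  "path_graph V E \<longleftrightarrow> (\<exists>p. distinct p \<and> V = set p \<and> E = set (path_edges p))"

definition star_graph :: "'a set \<Rightarrow> 'a set set \<Rightarrow> bool" where
  "star_graph V E \<longleftrightarrow> (\<exists>c\<in>V. E = (\<lambda>x. {c, x}) ` (V - {c}))"

definition deg :: "'a set set \<Rightarrow> 'a \<Rightarrow> nat" where
  "deg E x = card (nbrs E x)"

definition leaf_edge :: "'a set set \<Rightarrow> 'a set \<Rightarrow> bool" where
  "leaf_edge E e \<longleftrightarrow> e \<in> E \<and> (\<exists>x\<in>e. deg E x = 1)"

definition internal_edge :: "'a set set \<Rightarrow> 'a set \<Rightarrow> bool" where
  "internal_edge E e \<longleftrightarrow> e \<in> E \<and> \<not> leaf_edge E e"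

definition leaf_deg :: "'a set set \<Rightarrow> 'a \<Rightarrow> nat" where
  "leaf_deg E x = card {e. leaf_edge E e \<and> x \<in> e}"

definition graph_dist :: "'a set set \<Rightarrow> ('a set \<Rightarrow> real) \<Rightarrow> 'a \<Rightarrow> 'a \<Rightarrow> real" where
  "graph_dist E w x y = (INF p\<in>paths E x y. sum_list (map w (path_edges p)))"

definition wdeg :: "'a set set \<Rightarrow> ('a set \<Rightarrow> real) \<Rightarrow> 'a \<Rightarrow> real" where
  "wdeg E w x = (\<Sum>z\<in>nbrs E x. 1 / w {x, z})"

definition lazy_mass :: "'a set set \<Rightarrow> ('a set \<Rightarrow> real) \<Rightarrow> real \<Rightarrow> 'a \<Rightarrow> 'a \<Rightarrow> real" where
  "lazy_mass E w \<alpha> x y =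
     (if y = x then \<alpha>
      else if y \<in> nbrs E x then (1 - \<alpha>) * (1 / w {x, y}) / wdeg E w x
      else 0)"

definition lazy_pmf :: "'a set set \<Rightarrow> ('a set \<Rightarrow> real) \<Rightarrow> real \<Rightarrow> 'a \<Rightarrow> 'a pmf" where
  "lazy_pmf E w \<alpha> x = embed_pmf (lazy_mass E w \<alpha> x)"

text \<open>\<^const>\<open>embed_pmf\<close> is unspecified on functions that are not mass functions; the following
  shows that this does not happen in the intended range of parameters.\<close>

lemma pmf_lazy_pmf:
  assumes "simple_graph V E" and pos: "\<forall>e\<in>E. w e > 0"
    and ne: "nbrs E x \<noteq> {}" and a: "0 \<le> \<alpha>" "\<alpha> \<le> 1"
  shows "pmf (lazy_pmf E w \<alpha> x) y = lazy_mass E w \<alpha> x y"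
proof -
  let ?N = "nbrs E x" and ?D = "wdeg E w x" and ?f = "lazy_mass E w \<alpha> x"
  have xN: "x \<notin> ?N" and sub: "?N \<subseteq> V" and finV: "finite V"
    using assms(1) by (force simp: simple_graph_def nbrs_def)+
  have fin: "finite ?N" using sub finV finite_subset by blast
  have posN: "w {x, z} > 0" if "z \<in> ?N" for z using that pos by (simp add: nbrs_def)
  have D: "?D > 0" unfolding wdeg_def using fin ne posN by (intro sum_pos) auto
  have nn: "?f z \<ge> 0" for z
    using a D posN[of z] by (auto simp: lazy_mass_def intro!: divide_nonneg_nonneg)
  have "(\<Sum>z\<in>?N. ?f z) = (\<Sum>z\<in>?N. (1 - \<alpha>) / ?D * (1 / w {x, z}))"
    using xN by (intro sum.cong) (auto simp: lazy_mass_def)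
  also have "\<dots> = (1 - \<alpha>) / ?D * ?D" by (simp only: wdeg_def sum_distrib_left)
  finally have "(\<Sum>z\<in>insert x ?N. ?f z) = 1"
    using fin xN D by (simp add: lazy_mass_def)
  moreover have "(\<integral>\<^sup>+z. ennreal (?f z) \<partial>count_space UNIV) = (\<Sum>z\<in>insert x ?N. ennreal (?f z))"
    using fin by (intro nn_integral_count_space') (auto simp: lazy_mass_def)
  ultimately have "(\<integral>\<^sup>+z. ennreal (?f z) \<partial>count_space UNIV) = 1"
    using nn by (simp add: sum_ennreal del: sum.insert)
  then show ?thesis unfolding lazy_pmf_def using nn by (intro pmf_embed_pmf) auto
qed

definition wasserstein :: "('a \<Rightarrow> 'a \<Rightarrow> real) \<Rightarrow> 'a pmf \<Rightarrow> 'a pmf \<Rightarrow> real" where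
  "wasserstein d p q =
     (INF r\<in>{r. map_pmf fst r = p \<and> map_pmf snd r = q}.
        measure_pmf.expectation r (\<lambda>(a, b). d a b))"

definition ollivier_curv ::
  "'a set set \<Rightarrow> ('a set \<Rightarrow> real) \<Rightarrow> real \<Rightarrow> 'a \<Rightarrow> 'a \<Rightarrow> real" where
  "ollivier_curv E w \<alpha> x y =
     1 - wasserstein (graph_dist E w) (lazy_pmf E w \<alpha> x) (lazy_pmf E w \<alpha> y) / graph_dist E w x y"

text \<open>The laziness \<open>\<alpha>\<close> ranges over \<open>[0, 1)\<close>, so the limit is taken from the left.\<close>

definition lly_curv :: "'a set set \<Rightarrow> ('a set \<Rightarrow> real) \<Rightarrow> 'a \<Rightarrow> 'a \<Rightarrow> real" where
  "lly_curv E w x y = Lim (at_left 1) (\<lambda>\<alpha>. ollivier_curv E w \<alpha> x y / (1 - \<alpha>))"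

text \<open>The flow equation is stated for both orientations of every edge; the curvature is symmetric
  in its two vertices.  The derivative at time \<open>0\<close> is one-sided.\<close>

definition ricci_flow :: "'a set set \<Rightarrow> (real \<Rightarrow> 'a set \<Rightarrow> real) \<Rightarrow> bool" where
  "ricci_flow E w \<longleftrightarrow>
     (\<forall>t\<ge>0. \<forall>e\<in>E. w t e > 0) \<and>
     (\<forall>t\<ge>0. \<forall>x y. {x, y} \<in> E \<longrightarrow>
        ((\<lambda>s. w s {x, y}) has_real_derivative - lly_curv E (w t) x y * w t {x, y})
          (at t within {0..}))"

end

theory Submission
  imports Defs
begin

text \<open>
  On a tree the curvature of an edge \<open>xy\<close> is
  \<open>(2 - d\<^sub>x) / (w\<^sub>x\<^sub>y D\<^sub>x) + (2 - d\<^sub>y) / (w\<^sub>x\<^sub>y D\<^sub>y)\<close>: an explicit coupling is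
  optimal because a potential that changes by at most \<open>w\<^sub>e\<close> across each edge \<open>e\<close> is tight on its
  support. With \<open>F\<^sub>x = (d\<^sub>x - 2) / D\<^sub>x\<close> the flow reads
  \<open>w\<^sub>x\<^sub>y' = F\<^sub>x + F\<^sub>y\<close>, and \<open>F\<^sub>x = - w\<^sub>e\<close> at the degree one end of a leaf edge \<open>e\<close>.

  Suppose \<open>d\<^sub>u \<ge> 3\<close>, and let \<open>L\<close> be the total weight of the \<open>m \<ge> d\<^sub>u - 2\<close> leaf edges at \<open>u\<close> and \<open>W\<close> the
  weight of \<open>uv\<close>. Then \<open>L' = m F\<^sub>u - L\<close> and \<open>W' \<ge> F\<^sub>u\<close>, while \<open>D\<^sub>u \<ge> m\<^sup>2 / L + 1 / W\<close> by the
  Cauchy-Schwarz inequality. Hence \<open>q = L / W\<close> satisfies \<open>q' \<le> - q\<^sup>2 / (m\<^sup>2 + q)\<close>, so it tends to 0,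
  and so does \<open>F\<^sub>u / W \<le> q / m\<close>; the same holds at \<open>v\<close>.
\<close>

section \<open>Trees\<close>

text \<open>If the new endpoint already lies on the path, the path is cut at that occurrence, which
  keeps its vertices distinct. Reachability thus yields simple paths, as \<open>cycle\<close>
  demands.\<close>

lemma rtrancl_obtain_distinct_path:
  assumes "(x, y) \<in> {(a, b). R a b}\<^sup>*"
  obtains p where "p \<noteq> []" "distinct p" "successively R p" "hd p = x" "last p = y"
proof -
  from assms have "\<exists>p. p \<noteq> [] \<and> distinct p \<and> successively R p \<and> hd p = x \<and> last p = y"
  proof (induction rule: rtrancl_induct)
    case base
    show ?case by (intro exI[of _ "[x]"]) simp
  next
    case (step a b)
    then obtain p where p: "p \<noteq> []" "distinct p" "successively R p" "hd p = x" "last p = a"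
      by blast
    show ?case
    proof (cases "b \<in> set p")
      case False
      with p step.hyps show ?thesis
        by (intro exI[of _ "p @ [b]"]) (auto simp: successively_append_iff)
    next
      case True
      then obtain ps qs where "p = ps @ b # qs" by (meson split_list)
      with p show ?thesis
        by (intro exI[of _ "ps @ [b]"]) (auto simp: successively_append_iff hd_append split: if_splits)
    qed
  qed
  with that show ?thesis by blast
qed

lemma finite_edges: "simple_graph V E \<Longrightarrow> finite E"
  unfolding simple_graph_def by (rule finite_subset[of _ "Pow V"]) auto

lemma finite_nbrs: "simple_graph V E \<Longrightarrow> finite (nbrs E x)"
  unfolding simple_graph_def nbrs_def by (rule finite_subset[of _ V]) auto

lemma edge_neq: "simple_graph V E \<Longrightarrow> {x, y} \<in> E \<Longrightarrow> x \<noteq> y"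
  unfolding simple_graph_def by (auto simp: card_insert_if)

lemma edge_obtain:
  assumes "simple_graph V E" "e \<in> E" "x \<in> e"
  obtains y where "e = {x, y}"
proof -
  from assms have "card e = 2" by (auto simp: simple_graph_def)
  with \<open>x \<in> e\<close> that show ?thesis by (auto simp: card_2_iff)
qed

text \<open>Deleting the edge \<open>e\<close> splits the tree into two sides; \<open>S\<close> is the side not containing \<open>x\<close>.\<close>

lemma tree_edge_cut:
  assumes tree: "finite_tree V E" and "e \<in> E"
  shows "\<exists>S. x \<notin> S \<and> (\<forall>a b. {a, b} \<in> E \<longrightarrow> ((a \<in> S) \<noteq> (b \<in> S)) = ({a, b} = e))"
proof -
  have sg: "simple_graph V E" using tree by (simp add: finite_tree_def)
  then obtain c d where e: "e = {c, d}"
    using \<open>e \<in> E\<close> by (auto simp: simple_graph_def card_2_iff)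
  have "c \<noteq> d" using edge_neq[OF sg] \<open>e \<in> E\<close> e by blast
  define R where "R = (\<lambda>a b. {a, b} \<in> E \<and> {a, b} \<noteq> e)"
  define S where "S = {a. (c, a) \<in> {(a, b). R a b}\<^sup>*}"
  have "c \<in> S" by (simp add: S_def)
  have "d \<notin> S"
  proof
    assume "d \<in> S"
    then obtain p where p: "p \<noteq> []" "distinct p" "successively R p" "hd p = c" "last p = d"
      unfolding S_def using rtrancl_obtain_distinct_path by (metis mem_Collect_eq)
    have "successively (\<lambda>a b. {a, b} \<in> E) p"
      using p(3) by (rule successively_mono) (simp_all add: R_def)
    \<comment> \<open>With fewer than three vertices the path would be trivial, against
      \<open>c \<noteq> d\<close>, or would be the edge \<open>e\<close> itself, which
      \<open>R\<close> forbids.\<close>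
    moreover have "length p \<ge> 3"
    proof (rule ccontr)
      assume "\<not> length p \<ge> 3"
      then have "length p = 1 \<or> length p = 2" using p(1) by (simp add: le_Suc_eq numeral_3_eq_3 numeral_2_eq_2 not_le less_Suc_eq)
      then show False
        using p \<open>c \<noteq> d\<close> by (auto simp: length_Suc_conv numeral_2_eq_2 R_def e)
    qed
    ultimately have "cycle E p"
      using p \<open>e \<in> E\<close> e by (simp add: cycle_def insert_commute)
    with tree show False by (auto simp: finite_tree_def)
  qed
  have step: "b \<in> S" if "R a b" "a \<in> S" for a b
    using that unfolding S_def by (auto intro: rtrancl_into_rtrancl)
  have cut: "((a \<in> S) \<noteq> (b \<in> S)) = ({a, b} = e)" if "{a, b} \<in> E" for a b
  proof (cases "{a, b} = e")
    case True
    then show ?thesis using \<open>c \<in> S\<close> \<open>d \<notin> S\<close> by (auto simp: e doubleton_eq_iff)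
  next
    case False
    then have "R a b" "R b a" using that by (auto simp: R_def insert_commute)
    with step False show ?thesis by blast
  qed
  show ?thesis
  \<comment> \<open>The cut property is invariant under complement, so a side that misses
    \<open>x\<close> can be chosen.\<close>
  proof (cases "x \<in> S")
    case True
    with cut show ?thesis by (intro exI[of _ "- S"]) auto
  next
    case False
    with cut show ?thesis by (intro exI[of _ S]) auto
  qed
qed

section \<open>The curvature of an edge of a tree\<close>

text \<open>The potential of the Kantorovich dual problem: \<open>\<phi>\<close> increases away from \<open>{x, y}\<close> on the side
  of \<open>x\<close> and decreases away from it on the side of \<open>y\<close>.\<close>

lemma tree_potential:
  assumes tree: "finite_tree V E" and pos: "\<forall>e\<in>E. w e > (0::real)" and xy: "{x, y} \<in> E"
  obtains \<phi> :: "'a \<Rightarrow> real" where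
    "\<And>a b. {a, b} \<in> E \<Longrightarrow> \<phi> a - \<phi> b \<le> w {a, b}"
    "\<phi> x = 0" "\<phi> y = - w {x, y}"
    "\<And>z. z \<in> nbrs E x \<Longrightarrow> z \<noteq> y \<Longrightarrow> \<phi> z = w {x, z}"
    "\<And>z. z \<in> nbrs E y \<Longrightarrow> z \<noteq> x \<Longrightarrow> \<phi> z = - w {x, y} - w {y, z}"
proof -
  have sg: "simple_graph V E" using tree by (simp add: finite_tree_def)
  have "x \<noteq> y" using edge_neq[OF sg xy] .
  have "\<forall>e\<in>E. \<exists>S. x \<notin> S \<and> (\<forall>a b. {a, b} \<in> E \<longrightarrow> ((a \<in> S) \<noteq> (b \<in> S)) = ({a, b} = e))"
    using tree_edge_cut[OF tree] by (intro ballI)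
  from bchoice[OF this] obtain S where
    S: "\<forall>e\<in>E. x \<notin> S e \<and> (\<forall>a b. {a, b} \<in> E \<longrightarrow> ((a \<in> S e) \<noteq> (b \<in> S e)) = ({a, b} = e))" ..
  then have xS: "x \<notin> S e" if "e \<in> E" for e using that by simp
  have cut: "((a \<in> S e) \<noteq> (b \<in> S e)) = ({a, b} = e)" if "e \<in> E" "{a, b} \<in> E" for e a b
    using S that by simp
  \<comment> \<open>Edges at \<open>y\<close> lower the potential when crossed away from
    \<open>x\<close>, all others raise it. Beyond the neighbours of \<open>y\<close> the sign is a
    mere convention: only the bound by \<open>w e\<close> matters there.\<close>
  define c where "c = (\<lambda>e. if y \<in> e then - w e else w e)"
  define \<phi> where "\<phi> = (\<lambda>a. \<Sum>e\<in>E. c e * of_bool (a \<in> S e))"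
  \<comment> \<open>No edge other than \<open>{a, b}\<close> separates \<open>a\<close> from
    \<open>b\<close>, so a single term of the sum survives.\<close>
  have diff: "\<phi> a - \<phi> b = c {a, b} * (of_bool (a \<in> S {a, b}) - of_bool (b \<in> S {a, b}))"
    if ab: "{a, b} \<in> E" for a b
  proof -
    have "\<phi> a - \<phi> b = (\<Sum>e\<in>E. c e * (of_bool (a \<in> S e) - of_bool (b \<in> S e)))"
      by (simp add: \<phi>_def sum_subtractf right_diff_distrib)
    also have "\<dots> = (\<Sum>e\<in>{{a, b}}. c e * (of_bool (a \<in> S e) - of_bool (b \<in> S e)))"
    proof (rule sum.mono_neutral_right[OF finite_edges[OF sg]])
      show "\<forall>e\<in>E - {{a, b}}. c e * (of_bool (a \<in> S e) - of_bool (b \<in> S e)) = 0"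
      proof
        fix e assume "e \<in> E - {{a, b}}"
        then have "a \<in> S e \<longleftrightarrow> b \<in> S e" using cut[of e a b] ab by auto
        then show "c e * (of_bool (a \<in> S e) - of_bool (b \<in> S e)) = 0" by simp
      qed
    qed (use ab in auto)
    finally show ?thesis by simp
  qed
  have out: "\<phi> b - \<phi> a = c {a, b}" if ab: "{a, b} \<in> E" and "a \<notin> S {a, b}" for a b
    using diff[OF ab] cut[OF ab ab] that(2) by auto
  show ?thesis
  proof
    show "\<phi> a - \<phi> b \<le> w {a, b}" if ab: "{a, b} \<in> E" for a b
      using diff[OF ab] bspec[OF pos ab] by (auto simp: c_def)
    show x0: "\<phi> x = 0" using xS by (auto simp: \<phi>_def intro!: sum.neutral)
    have nbx: "\<phi> z = c {x, z}" if "{x, z} \<in> E" for z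
      using out[OF that xS[OF that]] x0 by simp
    show yv: "\<phi> y = - w {x, y}" using nbx[OF xy] by (simp add: c_def)
    show "\<phi> z = w {x, z}" if "z \<in> nbrs E x" "z \<noteq> y" for z
      using nbx[of z] that \<open>x \<noteq> y\<close> by (simp add: c_def nbrs_def)
    show "\<phi> z = - w {x, y} - w {y, z}" if "z \<in> nbrs E y" "z \<noteq> x" for z
    proof -
      have yz: "{y, z} \<in> E" using that by (simp add: nbrs_def)
      have "{x, y} \<noteq> {y, z}" using that \<open>x \<noteq> y\<close> by (auto simp: doubleton_eq_iff)
      then have "y \<notin> S {y, z}" using cut[OF yz xy] xS[OF yz] by auto
      from out[OF yz this] yv show ?thesis by (simp add: c_def)
    qed
  qed
qed

section \<open>Potentials and path distances\<close>

lemma path_weight_ge: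
  assumes "\<And>a b. {a, b} \<in> E \<Longrightarrow> \<phi> a - \<phi> b \<le> (w {a, b} :: real)"
    and "p \<noteq> []" "successively (\<lambda>a b. {a, b} \<in> E) p"
  shows "\<phi> (hd p) - \<phi> (last p) \<le> sum_list (map w (path_edges p))"
  using assms(2,3)
proof (induction p rule: induct_list012)
  case (3 a b p)
  then have "\<phi> b - \<phi> (last (b # p)) \<le> sum_list (map w (path_edges (b # p)))" by simp
  with assms(1)[of a b] 3(4) show ?case by (simp add: path_edges_def)
qed (auto simp: path_edges_def)

lemma graph_dist_ge:
  assumes "\<And>a b. {a, b} \<in> E \<Longrightarrow> \<phi> a - \<phi> b \<le> (w {a, b} :: real)"
    and "paths E x y \<noteq> {}"
  shows "\<phi> x - \<phi> y \<le> graph_dist E w x y"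
  unfolding graph_dist_def
proof (rule cINF_greatest[OF assms(2)])
  fix p assume "p \<in> paths E x y"
  with path_weight_ge[of E \<phi> w p] assms(1)
  show "\<phi> x - \<phi> y \<le> sum_list (map w (path_edges p))" by (auto simp: paths_def)
qed

text \<open>Positive weights bound the path lengths below by 0 (the zero potential), so the real
  infimum lies below each of them.\<close>

lemma graph_dist_le:
  assumes "\<forall>e\<in>E. w e > (0::real)" "p \<in> paths E x y"
  shows "graph_dist E w x y \<le> sum_list (map w (path_edges p))"
  unfolding graph_dist_def
proof (rule cINF_lower[OF _ assms(2)])
  have "0 \<le> sum_list (map w (path_edges q))" if "q \<in> paths E x y" for q
    using path_weight_ge[of E "\<lambda>_. 0" w q] that assms(1) by (auto simp: paths_def intro: less_imp_le)
  then show "bdd_below ((\<lambda>p. sum_list (map w (path_edges p))) ` paths E x y)"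
    by (intro bdd_belowI2[where m = 0])
qed

section \<open>Expectations and couplings of the lazy measures\<close>

lemma set_lazy_pmf:
  assumes "simple_graph V E" "\<forall>e\<in>E. w e > 0" "nbrs E x \<noteq> {}" "0 \<le> \<alpha>" "\<alpha> \<le> 1"
  shows "set_pmf (lazy_pmf E w \<alpha> x) \<subseteq> insert x (nbrs E x)"
    and "set_pmf (lazy_pmf E w 0 x) \<subseteq> nbrs E x"
  using pmf_lazy_pmf[OF assms(1-3)] assms(4,5)
  by (auto simp: set_pmf_iff lazy_mass_def split: if_splits)

lemma wdeg_pos:
  assumes "simple_graph V E" "\<forall>e\<in>E. w e > 0" "nbrs E x \<noteq> {}"
  shows "wdeg E w x > 0"
  unfolding wdeg_def using finite_nbrs[OF assms(1)] assms(2,3)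
  by (intro sum_pos) (auto simp: nbrs_def)

text \<open>Centring at \<open>\<phi> x\<close> leaves a sum of slopes along the edges at
  \<open>x\<close>. At both ends of the edge considered, the potential above has slopes 1 and -1
  only, so the sum depends on the degree alone.\<close>

lemma expectation_lazy_pmf:
  fixes \<phi> :: "'a \<Rightarrow> real"
  assumes "simple_graph V E" "\<forall>e\<in>E. w e > 0" "nbrs E x \<noteq> {}" "0 \<le> \<alpha>" "\<alpha> \<le> 1"
  shows "measure_pmf.expectation (lazy_pmf E w \<alpha> x) \<phi>
    = \<phi> x + (1 - \<alpha>) / wdeg E w x * (\<Sum>z\<in>nbrs E x. (\<phi> z - \<phi> x) / w {x, z})"
proof -
  let ?N = "nbrs E x"
  have fin: "finite ?N" using finite_nbrs assms(1) .
  have xN: "x \<notin> ?N" using edge_neq[OF assms(1), of x x] by (auto simp: nbrs_def)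
  have D: "wdeg E w x > 0" by (rule wdeg_pos[OF assms(1-3)])
  have "measure_pmf.expectation (lazy_pmf E w \<alpha> x) \<phi>
      = (\<Sum>z\<in>insert x ?N. lazy_mass E w \<alpha> x z * \<phi> z)"
    using fin set_lazy_pmf(1)[OF assms]
    by (subst integral_measure_pmf[of "insert x ?N"]) (auto simp: pmf_lazy_pmf[OF assms])
  also have "\<dots> = \<alpha> * \<phi> x + (\<Sum>z\<in>?N. (1 - \<alpha>) / wdeg E w x * (\<phi> z / w {x, z}))"
    using fin xN by (auto simp: lazy_mass_def intro!: sum.cong)
  also have "\<dots> = \<alpha> * \<phi> x + (1 - \<alpha>) / wdeg E w x * (\<Sum>z\<in>?N. \<phi> z / w {x, z})"
    by (simp add: sum_distrib_left)
  also have "(\<Sum>z\<in>?N. \<phi> z / w {x, z}) = (\<Sum>z\<in>?N. (\<phi> z - \<phi> x) / w {x, z}) + \<phi> x * wdeg E w x"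
    by (simp add: wdeg_def sum_distrib_left diff_divide_distrib sum_subtractf)
  also have "\<alpha> * \<phi> x + (1 - \<alpha>) / wdeg E w x * \<dots>
      = \<phi> x + (1 - \<alpha>) / wdeg E w x * (\<Sum>z\<in>?N. (\<phi> z - \<phi> x) / w {x, z})"
    using D by (simp add: field_simps)
  finally show ?thesis .
qed

text \<open>The optimal coupling, for \<open>1/2 \<le> \<alpha>\<close>: mass \<open>2 * \<alpha> - 1\<close> moves from \<open>x\<close> to \<open>y\<close>, the mass
  \<open>1 - \<alpha>\<close> at the neighbours of \<open>x\<close> moves to \<open>y\<close>, and mass \<open>1 - \<alpha>\<close> moves from \<open>x\<close> to the
  neighbours of \<open>y\<close>.\<close>

lemma lazy_coupling:
  assumes sg: "simple_graph V E" and pos: "\<forall>e\<in>E. w e > 0"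
    and ne: "nbrs E x \<noteq> {}" "nbrs E y \<noteq> {}" and a: "1/2 \<le> \<alpha>" "\<alpha> \<le> 1"
  obtains r where "map_pmf fst r = lazy_pmf E w \<alpha> x" "map_pmf snd r = lazy_pmf E w \<alpha> y"
    "set_pmf r \<subseteq> insert (x, y) (nbrs E x \<times> {y} \<union> {x} \<times> nbrs E y)"
proof
  \<comment> \<open>The first coin leaves mass \<open>2 * (1 - \<alpha>)\<close>, which a fair coin
    splits between the two remaining transports. Laziness 0 gives the distributions on the
    neighbours, normalised to total mass one.\<close>
  let ?\<nu> = "lazy_pmf E w 0"
  let ?f = "\<lambda>c. if c then map_pmf (\<lambda>z. (z, y)) (?\<nu> x) else map_pmf (Pair x) (?\<nu> y)"
  let ?g = "\<lambda>b. if b then return_pmf (x, y) else bind_pmf (bernoulli_pmf (1/2)) ?f"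
  let ?r = "bind_pmf (bernoulli_pmf (2 * \<alpha> - 1)) ?g"
  note P = pmf_lazy_pmf[OF sg pos]
  show "map_pmf fst ?r = lazy_pmf E w \<alpha> x"
    using a by (intro pmf_eqI)
      (simp add: map_bind_pmf if_distrib[of "map_pmf fst"] map_pmf_comp pmf_bind P ne
        lazy_mass_def indicator_def field_simps, simp add: add_divide_distrib[symmetric])
  show "map_pmf snd ?r = lazy_pmf E w \<alpha> y"
    using a by (intro pmf_eqI)
      (simp add: map_bind_pmf if_distrib[of "map_pmf snd"] map_pmf_comp pmf_bind P ne
        lazy_mass_def indicator_def field_simps, simp add: add_divide_distrib[symmetric])
  show "set_pmf ?r \<subseteq> insert (x, y) (nbrs E x \<times> {y} \<union> {x} \<times> nbrs E y)"
    using set_lazy_pmf(2)[OF sg pos ne(1), of 0] set_lazy_pmf(2)[OF sg pos ne(2), of 0]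
    by (auto split: if_splits)
qed

text \<open>The marginals fix the expectation of \<open>\<phi> a - \<phi> b\<close>, so it bounds
  the cost of every coupling from below, and tightness on the support of \<open>r\<close> makes the
  bound attained. Finite supports give integrability.\<close>

lemma wasserstein_eq_dual:
  assumes fin: "finite (set_pmf p)" "finite (set_pmf q)"
    and lip: "\<And>a b. a \<in> set_pmf p \<Longrightarrow> b \<in> set_pmf q \<Longrightarrow> \<phi> a - \<phi> b \<le> d a b"
    and r: "map_pmf fst r = p" "map_pmf snd r = q"
    and tight: "\<And>a b. (a, b) \<in> set_pmf r \<Longrightarrow> d a b \<le> \<phi> a - \<phi> b"
  shows "wasserstein d p q = measure_pmf.expectation p \<phi> - measure_pmf.expectation q \<phi>"
proof -
  let ?C = "{r. map_pmf fst r = p \<and> map_pmf snd r = q}"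
  let ?K = "measure_pmf.expectation p \<phi> - measure_pmf.expectation q \<phi>"
  have sub: "set_pmf s \<subseteq> set_pmf p \<times> set_pmf q" if "s \<in> ?C" for s
    using that by auto (metis fst_conv imageI, metis snd_conv imageI)
  have finr: "finite (set_pmf s)" if "s \<in> ?C" for s
    using finite_subset[OF sub[OF that]] fin by simp
  have K: "measure_pmf.expectation s (\<lambda>(a, b). \<phi> a - \<phi> b) = ?K" if "s \<in> ?C" for s
  proof -
    from that have "?K = measure_pmf.expectation (map_pmf fst s) \<phi> - measure_pmf.expectation (map_pmf snd s) \<phi>"
      by simp
    also have "\<dots> = measure_pmf.expectation s (\<lambda>z. \<phi> (fst z) - \<phi> (snd z))"
      unfolding integral_map_pmf
      by (rule Bochner_Integration.integral_diff[symmetric])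
        (use finr[OF that] in \<open>auto intro: integrable_measure_pmf_finite\<close>)
    finally show ?thesis by (simp add: case_prod_unfold)
  qed
  have ge: "?K \<le> measure_pmf.expectation s (\<lambda>(a, b). d a b)" if "s \<in> ?C" for s
    unfolding K[OF that, symmetric] using finr[OF that] sub[OF that] lip
    by (intro integral_mono_AE) (auto intro: integrable_measure_pmf_finite simp: AE_measure_pmf_iff)
  have rC: "r \<in> ?C" using r by simp
  have "measure_pmf.expectation r (\<lambda>(a, b). d a b) \<le> ?K"
    unfolding K[OF rC, symmetric] using finr[OF rC] tight
    by (intro integral_mono_AE) (auto intro: integrable_measure_pmf_finite simp: AE_measure_pmf_iff)
  with ge[OF rC] have "measure_pmf.expectation r (\<lambda>(a, b). d a b) = ?K" by simp
  with ge rC show ?thesis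
    unfolding wasserstein_def by (intro cInf_eq_minimum) (auto intro: rev_image_eqI)
qed

text \<open>The potential and the coupling certify each other. The value is exactly linear in
  \<open>1 - \<alpha>\<close>, so the quotient defining \<open>lly_curv\<close> is constant near
  1.\<close>

lemma ollivier_curv_tree:
  assumes tree: "finite_tree V E" and pos: "\<forall>e\<in>E. w e > 0" and xy: "{x, y} \<in> E"
    and a: "1/2 \<le> \<alpha>" "\<alpha> \<le> 1"
  shows "ollivier_curv E w \<alpha> x y = (1 - \<alpha>) *
    ((2 - real (deg E x)) / (w {x, y} * wdeg E w x) + (2 - real (deg E y)) / (w {x, y} * wdeg E w y))"
proof -
  have sg: "simple_graph V E" and conn: "connected_graph V E"
    using tree by (simp_all add: finite_tree_def)
  have "x \<noteq> y" using edge_neq[OF sg xy] .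
  have W: "w {x, y} > 0" using pos xy by blast
  obtain \<phi> where lip: "\<And>a b. {a, b} \<in> E \<Longrightarrow> \<phi> a - \<phi> b \<le> w {a, b}"
    and px: "\<phi> x = 0" and py: "\<phi> y = - w {x, y}"
    and nx: "\<And>z. z \<in> nbrs E x \<Longrightarrow> z \<noteq> y \<Longrightarrow> \<phi> z = w {x, z}"
    and ny: "\<And>z. z \<in> nbrs E y \<Longrightarrow> z \<noteq> x \<Longrightarrow> \<phi> z = - w {x, y} - w {y, z}"
    using tree_potential[OF tree pos xy] by metis
  have yx: "y \<in> nbrs E x" "x \<in> nbrs E y" using xy by (auto simp: nbrs_def insert_commute)
  then have ne: "nbrs E x \<noteq> {}" "nbrs E y \<noteq> {}" by auto
  have inV: "insert z (nbrs E z) \<subseteq> V" if "z = x \<or> z = y" for z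
    using sg xy that by (force simp: simple_graph_def nbrs_def)
  have dge: "\<phi> a - \<phi> b \<le> graph_dist E w a b" if "a \<in> V" "b \<in> V" for a b
    using conn that by (intro graph_dist_ge lip) (auto simp: connected_graph_def)
  \<comment> \<open>On the support of the coupling, explicit paths with at most three vertices
    attain the bound given by the potential.\<close>
  have dle: "graph_dist E w a b \<le> \<phi> a - \<phi> b"
    if "(a, b) \<in> insert (x, y) (nbrs E x \<times> {y} \<union> {x} \<times> nbrs E y)" for a b
  proof -
    note G = graph_dist_le[OF pos]
    have 1: "graph_dist E w x y \<le> \<phi> x - \<phi> y"
      using G[of "[x, y]" x y] xy \<open>x \<noteq> y\<close> by (simp add: paths_def path_edges_def px py)
    have 2: "graph_dist E w z z \<le> 0" for z
      using G[of "[z]" z z] by (simp add: paths_def path_edges_def)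
    have 3: "graph_dist E w z y \<le> \<phi> z - \<phi> y" if "z \<in> nbrs E x" for z
    proof (cases "z = y")
      case False
      have "{x, z} \<in> E" using that by (simp add: nbrs_def)
      with edge_neq[OF sg this] False G[of "[z, x, y]" z y] xy \<open>x \<noteq> y\<close> nx[OF that] py show ?thesis
        by (simp add: paths_def path_edges_def insert_commute)
    qed (simp add: 2)
    have 4: "graph_dist E w x z \<le> \<phi> x - \<phi> z" if "z \<in> nbrs E y" for z
    proof (cases "z = x")
      case False
      have "{y, z} \<in> E" using that by (simp add: nbrs_def)
      with edge_neq[OF sg this] False G[of "[x, y, z]" x z] xy \<open>x \<noteq> y\<close> ny[OF that] px show ?thesis
        by (simp add: paths_def path_edges_def)
    qed (simp add: 2)
    from 1 3 4 that show ?thesis by auto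
  qed
  have dist: "graph_dist E w x y = w {x, y}"
    using dge[of x y] dle[of x y] inV[of x] inV[of y] by (simp add: px py)
  have a0: "0 \<le> \<alpha>" using a by simp
  obtain r where r: "map_pmf fst r = lazy_pmf E w \<alpha> x" "map_pmf snd r = lazy_pmf E w \<alpha> y"
    "set_pmf r \<subseteq> insert (x, y) (nbrs E x \<times> {y} \<union> {x} \<times> nbrs E y)"
    using lazy_coupling[OF sg pos ne a] by blast
  note supp = set_lazy_pmf(1)[OF sg pos ne(1) a0 a(2)] set_lazy_pmf(1)[OF sg pos ne(2) a0 a(2)]
  have was: "wasserstein (graph_dist E w) (lazy_pmf E w \<alpha> x) (lazy_pmf E w \<alpha> y)
      = measure_pmf.expectation (lazy_pmf E w \<alpha> x) \<phi> - measure_pmf.expectation (lazy_pmf E w \<alpha> y) \<phi>"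
  proof (rule wasserstein_eq_dual[OF _ _ _ r(1,2)])
    show "finite (set_pmf (lazy_pmf E w \<alpha> x))" "finite (set_pmf (lazy_pmf E w \<alpha> y))"
      using supp finite_nbrs[OF sg] by (meson finite_insert finite_subset)+
    show "\<phi> a - \<phi> b \<le> graph_dist E w a b"
      if "a \<in> set_pmf (lazy_pmf E w \<alpha> x)" "b \<in> set_pmf (lazy_pmf E w \<alpha> y)" for a b
      using that supp inV[of x] inV[of y] by (intro dge) blast+
    show "graph_dist E w a b \<le> \<phi> a - \<phi> b" if "(a, b) \<in> set_pmf r" for a b
      using that r(3) by (intro dle) blast
  qed
  have wne: "w {z, z'} \<noteq> 0" if "z' \<in> nbrs E z" for z z'
    using that pos by (force simp: nbrs_def)
  have cardN: "real (card (nbrs E z - {z'})) = real (deg E z) - 1" if "z' \<in> nbrs E z" for z z'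
    using card.remove[OF finite_nbrs[OF sg] that] by (simp add: deg_def)
  \<comment> \<open>The slope is -1 toward \<open>y\<close> and 1 toward each other neighbour of
    \<open>x\<close>; at \<open>y\<close> the signs are reversed.\<close>
  have "(\<Sum>z\<in>nbrs E x. (\<phi> z - \<phi> x) / w {x, z}) = - 1 + (\<Sum>z\<in>nbrs E x - {y}. 1)"
    using yx W finite_nbrs[OF sg]
    by (subst sum.remove[of _ y]) (auto simp: px py nx wne intro!: sum.cong)
  then have sx: "(\<Sum>z\<in>nbrs E x. (\<phi> z - \<phi> x) / w {x, z}) = real (deg E x) - 2"
    using cardN[OF yx(1)] by simp
  have "(\<Sum>z\<in>nbrs E y. (\<phi> z - \<phi> y) / w {y, z}) = 1 + (\<Sum>z\<in>nbrs E y - {x}. - 1)"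
    using yx W finite_nbrs[OF sg]
    by (subst sum.remove[of _ x]) (auto simp: px py ny wne insert_commute[of y x] intro!: sum.cong)
  then have sy: "(\<Sum>z\<in>nbrs E y. (\<phi> z - \<phi> y) / w {y, z}) = 2 - real (deg E y)"
    using cardN[OF yx(2)] by simp
  have D: "wdeg E w x > 0" "wdeg E w y > 0" using wdeg_pos[OF sg pos] ne by blast+
  show ?thesis
    unfolding ollivier_curv_def was dist expectation_lazy_pmf[OF sg pos ne(1) a0 a(2)]
      expectation_lazy_pmf[OF sg pos ne(2) a0 a(2)] sx sy
    unfolding px py using W D by (simp add: field_simps)
qed

theorem lly_curv_tree:
  assumes "finite_tree V E" "\<forall>e\<in>E. w e > 0" "{x, y} \<in> E"
  shows "lly_curv E w x y =
    (2 - real (deg E x)) / (w {x, y} * wdeg E w x) + (2 - real (deg E y)) / (w {x, y} * wdeg E w y)"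
    (is "_ = ?k")
proof -
  have "\<forall>\<^sub>F \<alpha> in at_left 1. \<alpha> \<in> {1/2<..<(1::real)}"
    by (rule eventually_at_left_real) simp
  then have "\<forall>\<^sub>F \<alpha> in at_left 1. ollivier_curv E w \<alpha> x y / (1 - \<alpha>) = ?k"
    by eventually_elim (simp add: ollivier_curv_tree[OF assms])
  then have "((\<lambda>\<alpha>. ollivier_curv E w \<alpha> x y / (1 - \<alpha>)) \<longlongrightarrow> ?k) (at_left 1)"
    by (rule tendsto_eventually)
  then show ?thesis unfolding lly_curv_def by (rule tendsto_Lim[OF trivial_limit_at_left_real])
qed

section \<open>The flow\<close>

text \<open>This is \<open>F\<^sub>x\<close> of the overview: what \<open>x\<close> contributes to
  the growth rate of each edge at \<open>x\<close>.\<close>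

definition drift :: "'a set set \<Rightarrow> ('a set \<Rightarrow> real) \<Rightarrow> 'a \<Rightarrow> real" where
  "drift E w x = (real (deg E x) - 2) / wdeg E w x"

lemma flow_pos: "ricci_flow E w \<Longrightarrow> t \<ge> 0 \<Longrightarrow> \<forall>e\<in>E. w t e > 0"
  by (simp add: ricci_flow_def)

lemma lly_curv_drift:
  assumes "finite_tree V E" "\<forall>e\<in>E. w e > 0" "{x, y} \<in> E"
  shows "lly_curv E w x y = - (drift E w x + drift E w y) / w {x, y}"
  using lly_curv_tree[OF assms] by (simp add: drift_def add_divide_distrib diff_divide_distrib mult.commute)

lemma flow_deriv:
  assumes "finite_tree V E" "ricci_flow E w" "{x, y} \<in> E" "t \<ge> 0"
  shows "((\<lambda>s. w s {x, y}) has_real_derivative drift E (w t) x + drift E (w t) y) (at t within {0..})"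
proof -
  have pos: "\<forall>e\<in>E. w t e > 0" using flow_pos[OF assms(2,4)] .
  then have "w t {x, y} \<noteq> 0" using assms(3) by force
  then have "- lly_curv E (w t) x y * w t {x, y} = drift E (w t) x + drift E (w t) y"
    by (simp add: lly_curv_drift[OF assms(1) pos assms(3)])
  moreover have "((\<lambda>s. w s {x, y}) has_real_derivative - lly_curv E (w t) x y * w t {x, y})
      (at t within {0..})"
    using assms by (simp add: ricci_flow_def)
  ultimately show ?thesis by simp
qed

section \<open>A differential inequality\<close>

lemma mono_from_deriv:
  fixes f :: "real \<Rightarrow> real"
  assumes d: "\<And>t. t \<ge> 0 \<Longrightarrow> (f has_real_derivative f' t) (at t within {0..})"
    and nn: "\<And>t. t \<ge> 0 \<Longrightarrow> f' t \<ge> 0" and t: "t \<ge> 0"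
  shows "f 0 \<le> f t"
proof (rule DERIV_nonneg_imp_increasing_open[OF t])
  show "\<exists>y. DERIV f s :> y \<and> y \<ge> 0" if "0 < s" "s < t" for s
  proof -
    \<comment> \<open>The derivative is two-sided at interior points; at 0 continuity
      suffices.\<close>
    have "at s within {0..} = at s" using that by (intro at_within_interior) simp
    with d[of s] nn[of s] that show ?thesis by auto
  qed
  have "continuous_on {0..} f"
    unfolding continuous_on_eq_continuous_within using d DERIV_continuous by blast
  then show "continuous_on {0..t} f" by (rule continuous_on_subset) auto
qed

text \<open>Here \<open>L\<close> is the total weight of the \<open>m\<close> leaf edges at \<open>u\<close> and \<open>W\<close> is the weight of the internal edge.
  The ratio \<open>W / L\<close> grows at least linearly.\<close>

lemma drift_ratio_tendsto_0:
  fixes L W F G :: "real \<Rightarrow> real" and m :: real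
  assumes dL: "\<And>t. t \<ge> 0 \<Longrightarrow> (L has_real_derivative m * F t - L t) (at t within {0..})"
    and dW: "\<And>t. t \<ge> 0 \<Longrightarrow> (W has_real_derivative F t + G t) (at t within {0..})"
    and L: "\<And>t. t \<ge> 0 \<Longrightarrow> L t > 0" and W: "\<And>t. t \<ge> 0 \<Longrightarrow> W t > 0"
    and F: "\<And>t. t \<ge> 0 \<Longrightarrow> F t \<ge> 0" and G: "\<And>t. t \<ge> 0 \<Longrightarrow> G t \<ge> 0"
    and m: "m \<ge> 1"
    and FL: "\<And>t. t \<ge> 0 \<Longrightarrow> F t * (m\<^sup>2 / L t + 1 / W t) \<le> m"
  shows "((\<lambda>t. F t / W t) \<longlongrightarrow> 0) at_top"
proof -
  define r where "r = (\<lambda>t. W t / L t)"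
  define r' where "r' = (\<lambda>t. ((F t + G t) * L t - W t * (m * F t - L t)) / (L t * L t))"
  have r: "r t > 0" if "t \<ge> 0" for t using L W that by (simp add: r_def)
  have dr: "(r has_real_derivative r' t) (at t within {0..})" if "t \<ge> 0" for t
    unfolding r_def r'_def using DERIV_divide[OF dW[OF that] dL[OF that]] L[OF that] by simp
  \<comment> \<open>Dropping the nonnegative terms with \<open>(F t + G t) * L t\<close> leaves
    \<open>W t * (L t - m * F t) / (L t * L t)\<close>, and \<open>FL\<close> bounds
    \<open>F t\<close> by \<open>m * L t * W t / (m\<^sup>2 * W t + L t)\<close>.\<close>
  have r': "r' t \<ge> r t / (m\<^sup>2 * r t + 1)" if t: "t \<ge> 0" for t
  proof -
    note p = L[OF t] W[OF t] F[OF t] G[OF t] FL[OF t]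
    have Q: "m\<^sup>2 * W t + L t > 0" using p by (intro add_nonneg_pos) auto
    have "F t * (m\<^sup>2 * W t + L t) \<le> m * (L t * W t)"
      using p by (simp add: field_simps)
    then have "m * (F t * (m\<^sup>2 * W t + L t)) \<le> m * (m * (L t * W t))"
      using m by (intro mult_left_mono) auto
    then have "L t * L t \<le> (L t - m * F t) * (m\<^sup>2 * W t + L t)"
      by (simp add: algebra_simps power2_eq_square)
    then have *: "L t * L t / (m\<^sup>2 * W t + L t) \<le> L t - m * F t"
      using Q by (simp add: pos_divide_le_eq)
    have "r t / (m\<^sup>2 * r t + 1) = W t * (L t * L t / (m\<^sup>2 * W t + L t)) / (L t * L t)"
      using p Q by (simp add: r_def divide_simps)
    also have "\<dots> \<le> W t * (L t - m * F t) / (L t * L t)"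
      using * p by (intro divide_right_mono mult_left_mono) auto
    also have "\<dots> \<le> r' t"
      unfolding r'_def using p by (intro divide_right_mono) (auto simp: algebra_simps)
    finally show ?thesis .
  qed
  have pm: "m\<^sup>2 * r t + 1 > 0" if "t \<ge> 0" for t using r[OF that] by (intro add_nonneg_pos) auto
  have rmono: "r 0 \<le> r t" if "t \<ge> 0" for t
  proof (rule mono_from_deriv[OF dr _ that])
    show "r' s \<ge> 0" if "s \<ge> 0" for s
      using r'[OF that] r[OF that] pm[OF that] by (meson divide_pos_pos less_imp_le order_trans)
  qed
  \<comment> \<open>The map sending \<open>s\<close> to \<open>s / (m\<^sup>2 * s + 1)\<close> is
    increasing and \<open>r\<close> stays above \<open>r 0\<close>, so \<open>c\<close> bounds
    \<open>r'\<close> from below.\<close>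
  define c where "c = r 0 / (m\<^sup>2 * r 0 + 1)"
  have c: "c > 0" unfolding c_def using r[of 0] pm[of 0] by simp
  have "c * t \<le> r t" if t: "t \<ge> 0" for t
  proof -
    have "r 0 - c * 0 \<le> r t - c * t"
    proof (rule mono_from_deriv[OF _ _ t])
      show "((\<lambda>t. r t - c * t) has_real_derivative r' s - c) (at s within {0..})" if "s \<ge> 0" for s
        by (rule derivative_eq_intros dr[OF that] refl)+ simp
      show "r' s - c \<ge> 0" if s: "s \<ge> 0" for s
      proof -
        have "c \<le> r s / (m\<^sup>2 * r s + 1)"
          unfolding c_def using rmono[OF s] pm[OF s] pm[of 0] by (simp add: field_simps)
        with r'[OF s] show ?thesis by simp
      qed
    qed
    with r[of 0] show ?thesis by simp
  qed
  then have bound: "F t / W t \<le> 1 / (c * t)" if t: "t > 0" for t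
  proof -
    have t0: "t \<ge> 0" using t by simp
    note p = L[OF t0] W[OF t0] F[OF t0] FL[OF t0]
    \<comment> \<open>Discarding \<open>1 / W t\<close> in \<open>FL\<close> gives
      \<open>F t * m \<le> L t\<close>; hence \<open>F t / W t\<close> is at most
      \<open>1 / r t\<close>.\<close>
    have "m * (F t * m / L t) \<le> F t * (m\<^sup>2 / L t + 1 / W t)"
      using p by (simp add: power2_eq_square algebra_simps)
    with p have "m * (F t * m / L t) \<le> m * 1" by simp
    then have "F t * m \<le> L t" using m p by (simp add: field_simps)
    moreover have "F t * 1 \<le> F t * m" using p m by (intro mult_left_mono) auto
    ultimately have "F t / W t \<le> L t / W t" using p by (intro divide_right_mono) auto
    also have "\<dots> = 1 / r t" by (simp add: r_def)
    also have "\<dots> \<le> 1 / (c * t)"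
      using \<open>\<And>t. t \<ge> 0 \<Longrightarrow> c * t \<le> r t\<close>[OF t0] c t by (intro divide_left_mono) (auto intro: mult_pos_pos r t0)
    finally show ?thesis .
  qed
  show ?thesis
  proof (rule tendsto_sandwich[OF _ _ tendsto_const])
    show "\<forall>\<^sub>F t in at_top. 0 \<le> F t / W t"
      using eventually_ge_at_top[of "0::real"]
      by eventually_elim (use F W in \<open>simp add: less_imp_le\<close>)
    show "\<forall>\<^sub>F t in at_top. F t / W t \<le> 1 / (c * t)"
      using eventually_gt_at_top[of "0::real"] by eventually_elim (rule bound)
    show "((\<lambda>t. 1 / (c * t)) \<longlongrightarrow> 0) at_top"
      using c by real_asymp
  qed
qed

section \<open>Estimates at a single vertex\<close>

lemma wdeg_eq_sum_edges:
  assumes "simple_graph V E"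
  shows "wdeg E w x = (\<Sum>e | e \<in> E \<and> x \<in> e. 1 / w e)"
proof -
  have "{e. e \<in> E \<and> x \<in> e} = (\<lambda>z. {x, z}) ` nbrs E x"
    using edge_obtain[OF assms] by (force simp: nbrs_def)
  moreover have "inj_on (\<lambda>z. {x, z}) (nbrs E x)" by (auto simp: inj_on_def doubleton_eq_iff)
  ultimately show ?thesis by (simp add: wdeg_def sum.reindex)
qed

text \<open>Cauchy-Schwarz for the square roots of \<open>f\<close> and their inverses.\<close>

lemma card_squared_le_sum_mult_sum_inverse:
  fixes f :: "'b \<Rightarrow> real"
  assumes "\<And>i. i \<in> A \<Longrightarrow> f i > 0"
  shows "(real (card A))\<^sup>2 \<le> (\<Sum>i\<in>A. f i) * (\<Sum>i\<in>A. 1 / f i)"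
proof -
  have "(\<Sum>i\<in>A. sqrt (f i) * (1 / sqrt (f i)))\<^sup>2
      \<le> (\<Sum>i\<in>A. (sqrt (f i))\<^sup>2) * (\<Sum>i\<in>A. (1 / sqrt (f i))\<^sup>2)"
    by (rule Cauchy_Schwarz_ineq_sum)
  also have "(\<Sum>i\<in>A. sqrt (f i) * (1 / sqrt (f i))) = (\<Sum>i\<in>A. 1)"
    using assms by (intro sum.cong) (auto dest: assms)
  also have "(\<Sum>i\<in>A. (sqrt (f i))\<^sup>2) = (\<Sum>i\<in>A. f i)"
    using assms by (intro sum.cong) (auto simp: less_imp_le)
  also have "(\<Sum>i\<in>A. (1 / sqrt (f i))\<^sup>2) = (\<Sum>i\<in>A. 1 / f i)"
    using assms by (intro sum.cong) (auto simp: power_divide less_imp_le)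
  finally show ?thesis by simp
qed

lemma internal_edge_deg:
  assumes sg: "simple_graph V E" and int: "internal_edge E {u, v}"
  shows "deg E u \<ge> 2"
proof -
  have "v \<in> nbrs E u" using int by (simp add: nbrs_def internal_edge_def)
  then have "deg E u \<noteq> 0" unfolding deg_def using finite_nbrs[OF sg, of u] by auto
  moreover have "deg E u \<noteq> 1" using int by (auto simp: internal_edge_def leaf_edge_def)
  ultimately show ?thesis by simp
qed

lemma drift_nonneg:
  assumes "simple_graph V E" "\<forall>e\<in>E. w e > 0" "deg E x \<ge> 2"
  shows "drift E w x \<ge> 0"
proof -
  have "nbrs E x \<noteq> {}" using assms(3) by (auto simp: deg_def)
  from wdeg_pos[OF assms(1,2) this] assms(3) show ?thesis by (simp add: drift_def)
qed

text \<open>The weighted degree has the single term \<open>1 / w {x, u}\<close>, and the numerator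
  is -1. This gives leaf edges their decay term.\<close>

lemma drift_leaf:
  assumes "{x, u} \<in> E" "deg E x = 1"
  shows "drift E w x = - w {x, u}"
proof -
  have "nbrs E x = {u}"
  proof -
    obtain z where "nbrs E x = {z}" using assms(2) unfolding deg_def by (rule card_1_singletonE)
    moreover have "u \<in> nbrs E x" using assms(1) by (simp add: nbrs_def)
    ultimately show ?thesis by simp
  qed
  then show ?thesis by (simp add: drift_def wdeg_def deg_def)
qed

lemma drift_over_internal_weight_tendsto_0:
  assumes tree: "finite_tree V E" and flow: "ricci_flow E w" and int: "internal_edge E {u, v}"
    and d: "deg E u = 2 \<or> int (leaf_deg E u) \<ge> int (deg E u) - 2"
  shows "((\<lambda>t. drift E (w t) u / w t {u, v}) \<longlongrightarrow> 0) at_top"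
proof (cases "deg E u = 2")
  case True
  then show ?thesis by (simp add: drift_def)
next
  case False
  have sg: "simple_graph V E" using tree by (simp add: finite_tree_def)
  note pos = flow_pos[OF flow]
  define A where "A = {e. leaf_edge E e \<and> u \<in> e}"
  define L where "L = (\<lambda>t. \<Sum>e\<in>A. w t e)"
  define m where "m = real (leaf_deg E u)"
  have uv: "{u, v} \<in> E" using int by (simp add: internal_edge_def)
  have AE: "A \<subseteq> E" by (auto simp: A_def leaf_edge_def)
  have finA: "finite A" using finite_subset[OF AE finite_edges[OF sg]] .
  have du: "deg E u \<ge> 3" using internal_edge_deg[OF sg int] False by simp
  have dv: "deg E v \<ge> 2" using internal_edge_deg[OF sg, of v u] int by (simp add: insert_commute)
  \<comment> \<open>Degree at least 3 forces at least one leaf edge at \<open>u\<close>, which makes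
    \<open>L\<close> positive.\<close>
  have m: "m \<ge> 1" "real (deg E u) - 2 \<le> m" using d False du by (auto simp: m_def)
  have mA: "m = real (card A)" by (simp add: m_def leaf_deg_def A_def)
  have dA: "((\<lambda>t. w t e) has_real_derivative drift E (w t) u - w t e) (at t within {0..})"
    if e: "e \<in> A" and t: "t \<ge> 0" for e t
  proof -
    from e AE obtain x where x: "e = {u, x}" using edge_obtain[OF sg, of e u] by (auto simp: A_def)
    have "{x, u} \<in> E" using e AE x by (auto simp: insert_commute)
    \<comment> \<open>The end of degree one cannot be \<open>u\<close>.\<close>
    moreover have "deg E x = 1" using e du by (auto simp: A_def leaf_edge_def x)
    ultimately show ?thesis
      using flow_deriv[OF tree flow _ t, of u x] by (simp add: drift_leaf[of x u] x insert_commute[of x u])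
  qed
  show ?thesis
  proof (rule drift_ratio_tendsto_0[where L = L and m = m and G = "\<lambda>t. drift E (w t) v"])
    fix t :: real assume t: "t \<ge> 0"
    have "(L has_real_derivative (\<Sum>e\<in>A. drift E (w t) u - w t e)) (at t within {0..})"
      unfolding L_def by (intro DERIV_sum dA t)
    then show "(L has_real_derivative m * drift E (w t) u - L t) (at t within {0..})"
      by (simp add: L_def mA sum_subtractf)
    show "((\<lambda>t. w t {u, v}) has_real_derivative drift E (w t) u + drift E (w t) v) (at t within {0..})"
      by (rule flow_deriv[OF tree flow uv t])
    show Lt: "L t > 0"
      unfolding L_def using finA m mA AE pos[OF t] by (intro sum_pos) auto
    show "w t {u, v} > 0" using pos[OF t] uv by blast
    show F: "drift E (w t) u \<ge> 0" using drift_nonneg[OF sg pos[OF t]] du by simp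
    show "drift E (w t) v \<ge> 0" using drift_nonneg[OF sg pos[OF t]] dv by simp
    have "m\<^sup>2 \<le> L t * (\<Sum>e\<in>A. 1 / w t e)"
      unfolding mA L_def using AE pos[OF t] by (intro card_squared_le_sum_mult_sum_inverse) auto
    then have "m\<^sup>2 / L t + 1 / w t {u, v} \<le> (\<Sum>e\<in>A. 1 / w t e) + 1 / w t {u, v}"
      using Lt by (simp add: field_simps)
    \<comment> \<open>The internal edge is not among the leaf edges, so its term is counted
      separately.\<close>
    also have "\<dots> = (\<Sum>e\<in>insert {u, v} A. 1 / w t e)"
      using int finA by (subst sum.insert) (auto simp: A_def internal_edge_def)
    also have "\<dots> \<le> (\<Sum>e | e \<in> E \<and> u \<in> e. 1 / w t e)"
      using AE uv finite_edges[OF sg] pos[OF t]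
      by (intro sum_mono2) (auto simp: A_def less_imp_le)
    finally have D: "m\<^sup>2 / L t + 1 / w t {u, v} \<le> wdeg E (w t) u"
      by (simp add: wdeg_eq_sum_edges[OF sg])
    have "wdeg E (w t) u > 0"
      using uv by (intro wdeg_pos[OF sg pos[OF t]]) (auto simp: nbrs_def)
    then have "drift E (w t) u * wdeg E (w t) u = real (deg E u) - 2"
      by (simp add: drift_def)
    with mult_left_mono[OF D F] m
    show "drift E (w t) u * (m\<^sup>2 / L t + 1 / w t {u, v}) \<le> m" by simp
  qed (rule m)
qed

theorem corollary2:
  fixes V :: "'a set" and E :: "'a set set" and w :: "real \<Rightarrow> 'a set \<Rightarrow> real" and u v :: 'a
  assumes "finite_tree V E"
    and "\<not> path_graph V E"
    and "\<not> star_graph V E"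
    and "ricci_flow E w"
    and "internal_edge E {u, v}"
    and "deg E u = 2 \<or> int (leaf_deg E u) \<ge> int (deg E u) - 2"
    and "deg E v = 2 \<or> int (leaf_deg E v) \<ge> int (deg E v) - 2"
  shows "((\<lambda>t. lly_curv E (w t) u v) \<longlongrightarrow> 0) at_top"
proof -
  have uv: "{u, v} \<in> E" using assms(5) by (simp add: internal_edge_def)
  have vu: "internal_edge E {v, u}" using assms(5) by (simp add: insert_commute)
  \<comment> \<open>The estimate is used at both ends, with the edge reversed for
    \<open>v\<close>.\<close>
  have "((\<lambda>t. - (drift E (w t) u / w t {u, v} + drift E (w t) v / w t {v, u})) \<longlongrightarrow> - (0 + 0)) at_top"
    by (intro tendsto_minus tendsto_add drift_over_internal_weight_tendsto_0[OF assms(1,4)] assms vu)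
  then have lim: "((\<lambda>t. - (drift E (w t) u + drift E (w t) v) / w t {u, v}) \<longlongrightarrow> 0) at_top"
    by (simp add: insert_commute[of v u] add_divide_distrib diff_divide_distrib)
  have "\<forall>\<^sub>F t in at_top. - (drift E (w t) u + drift E (w t) v) / w t {u, v} = lly_curv E (w t) u v"
    using eventually_ge_at_top[of 0]
    by eventually_elim (simp add: lly_curv_drift[OF assms(1) flow_pos[OF assms(4)] uv])
  from tendsto_cong[THEN iffD1, OF this lim] show ?thesis .
qed

end
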